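(* (a) There exist infinitely many graphs $G$ with $strc(G)=src(G)=3$. (b) For every integer $s\ge 13$, there exists a graph $G$ with $strc(G)=srvc(G)=s$. (c) For all integers $1\le t<s$, there exists a graph $G$ with $strc(G)\ge s$ and $srvc(G)=t$.
   Context: All graphs are finite, simple and connected; $u$–$v$ geodesic means a $u$–$v$ path of length $d(u,v)$. $src(G)$ is the minimum number of colours in an edge-colouring of $G$ in which any two vertices are joined by a geodesic whose edges have distinct colours. $srvc(G)$ is the minimum number of colours in a vertex-colouring in which any two vertices are joined by a geodesic whose internal vertices have distinct colours (value $0$ for complete graphs). $strc(G)$ is the minimum number of colours in a total-colouring (vertices and edges) in which any two vertices are joined by a geodesic whose edges and internal vertices all have pairwise distinct colours. *)

theory Defs
  imports "Graph_Theory.Graph_Theory"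
begin

text \<open>
  A finite simple graph is a \<open>pair_graph\<close>: a finite, loop-free, symmetric set of arcs
  given as pairs. The two arcs \<open>(u,v)\<close> and \<open>(v,u)\<close> represent one undirected edge, so edge
  colours are attached to \<open>{u,v}\<close>. Colourings need not be proper. They are total functions
  into \<open>nat\<close>, and only the colours taken on the coloured set are counted.
\<close>

definition fin_conn_graph :: "'a pair_pre_digraph \<Rightarrow> bool" where
  "fin_conn_graph G \<longleftrightarrow> pair_graph G \<and> connected (with_proj G)"

definition uedge :: "'a \<times> 'a \<Rightarrow> 'a set" where
  "uedge a = {fst a, snd a}"

definition uedges :: "'a pair_pre_digraph \<Rightarrow> 'a set set" where
  "uedges G = uedge ` parcs G"

text \<open>With unit weights, \<open>\<mu>\<close> is the graph distance. A path is given by its list of arcs.\<close>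

definition geodesic :: "'a pair_pre_digraph \<Rightarrow> 'a \<Rightarrow> ('a \<times> 'a) awalk \<Rightarrow> 'a \<Rightarrow> bool" where
  "geodesic G u p v \<longleftrightarrow>
     pre_digraph.apath (with_proj G) u p v \<and>
     ereal (real (length p)) = wf_digraph.\<mu> (with_proj G) (\<lambda>_. 1) u v"

definition strong_rainbow_edge_colouring :: "'a pair_pre_digraph \<Rightarrow> ('a set \<Rightarrow> nat) \<Rightarrow> bool" where
  "strong_rainbow_edge_colouring G c \<longleftrightarrow>
     (\<forall>u \<in> pverts G. \<forall>v \<in> pverts G. \<exists>p. geodesic G u p v \<and> distinct (map (\<lambda>a. c (uedge a)) p))"

definition strong_rainbow_vertex_colouring :: "'a pair_pre_digraph \<Rightarrow> ('a \<Rightarrow> nat) \<Rightarrow> bool" where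
  "strong_rainbow_vertex_colouring G c \<longleftrightarrow>
     (\<forall>u \<in> pverts G. \<forall>v \<in> pverts G. \<exists>p. geodesic G u p v \<and>
        distinct (map c (pre_digraph.inner_verts (with_proj G) p)))"

text \<open>A total-colouring colours the disjoint union of the vertex set and the edge set.\<close>

definition strong_rainbow_total_colouring ::
    "'a pair_pre_digraph \<Rightarrow> ('a + 'a set \<Rightarrow> nat) \<Rightarrow> bool" where
  "strong_rainbow_total_colouring G c \<longleftrightarrow>
     (\<forall>u \<in> pverts G. \<forall>v \<in> pverts G. \<exists>p. geodesic G u p v \<and>
        distinct (map (\<lambda>a. c (Inr (uedge a))) p @
                  map (\<lambda>x. c (Inl x)) (pre_digraph.inner_verts (with_proj G) p)))"

definition src :: "'a pair_pre_digraph \<Rightarrow> nat" where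
  "src G = (LEAST k. \<exists>c. strong_rainbow_edge_colouring G c \<and> card (c ` uedges G) = k)"

text \<open>
  The case split is the convention that complete graphs have value 0; the minimum over
  colourings of the vertex set would be 1 there.
\<close>

definition srvc :: "'a pair_pre_digraph \<Rightarrow> nat" where
  "srvc G =
     (if \<exists>n. complete_digraph n (with_proj G) then 0
      else LEAST k. \<exists>c. strong_rainbow_vertex_colouring G c \<and> card (c ` pverts G) = k)"

definition strc :: "'a pair_pre_digraph \<Rightarrow> nat" where
  "strc G =
     (LEAST k. \<exists>c. strong_rainbow_total_colouring G c \<and> card (c ` (pverts G <+> uedges G)) = k)"

end

theory Submission
  imports Defs "HOL-Library.Countable"
begin

text \<open>
  (a) Blow up one vertex of the five-cycle to a clique. Colouring each vertex of the cycle with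
  the colour missing at its two properly 3-coloured edges makes all geodesics of length 2 rainbow,
  while two edge colours would have to alternate around an odd cycle.

  (b) Take a clique on \<open>1,\<dots>,s\<close> and attach, for all \<open>i < j\<close>, a vertex \<open>X i j\<close> to \<open>i\<close> and a vertex
  \<open>Y i j\<close> to \<open>j\<close>. If the path from \<open>X i j\<close> to \<open>Y i j\<close> along \<open>i\<close> and \<open>j\<close> is the only geodesic, the
  clique vertices need distinct colours. To let all other pairs escape through several geodesics,
  join \<open>X i j\<close> and \<open>X k l\<close> (likewise for \<open>Y\<close>) unless \<open>j = k\<close> or \<open>l = i\<close>; exactly these exceptions
  keep the path through \<open>i\<close> and \<open>j\<close> unique. Then colours from \<open>1,\<dots>,12\<close> suffice for everything
  outside the clique.

  (c) Attach \<open>s\<close> pendant vertices to every vertex of a clique on \<open>t\<close> vertices: the cut vertices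
  need distinct colours and so do the pendant edges at one vertex.
\<close>

section \<open>Short geodesics\<close>

text \<open>Equality, adjacency and this relation together decide whether a distance is 0, 1, 2 or
  larger, which suffices for graphs of diameter at most three.\<close>

definition common_nbr :: "'a pair_pre_digraph \<Rightarrow> 'a \<Rightarrow> 'a \<Rightarrow> bool" where
  "common_nbr G u v \<longleftrightarrow> (\<exists>w. (u,w) \<in> parcs G \<and> (w,v) \<in> parcs G)"

lemma uedge_pair [simp]: "uedge (u, v) = {u, v}"
  by (simp add: uedge_def)

context pair_graph
begin

lemma awalk_cost_unit: "awalk_cost (\<lambda>_. 1) p = real (length p)"
  by (induction p) simp_all

text \<open>The infimum of walk costs becomes a comparison of lengths: \<open>p\<close> is itself
  one of the walks, so only the bound from below carries information.\<close>

lemma geodesic_iff: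
  "geodesic G u p v \<longleftrightarrow> apath u p v \<and> (\<forall>q. awalk u q v \<longrightarrow> length p \<le> length q)"
proof -
  have "ereal (real (length p)) = \<mu> (\<lambda>_. 1) u v \<longleftrightarrow> (\<forall>q. awalk u q v \<longrightarrow> length p \<le> length q)"
    if "apath u p v"
  proof -
    have "awalk u p v" using that by (simp add: apath_def)
    then have le: "\<mu> (\<lambda>_. 1) u v \<le> ereal (real (length p))"
      unfolding \<mu>_def by (intro INF_lower2[of p]) (simp_all add: awalk_cost_unit)
    have "ereal (real (length p)) = \<mu> (\<lambda>_. 1) u v \<longleftrightarrow> ereal (real (length p)) \<le> \<mu> (\<lambda>_. 1) u v"
      using le by auto
    also have "\<dots> \<longleftrightarrow> (\<forall>q. awalk u q v \<longrightarrow> length p \<le> length q)"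
      unfolding \<mu>_def by (simp add: le_INF_iff awalk_cost_unit)
    finally show ?thesis .
  qed
  then show ?thesis unfolding geodesic_def by blast
qed

lemma awalk_length_cases:
  assumes "awalk u q v"
  shows "length q = 0 \<and> u = v \<or> length q = 1 \<and> (u,v) \<in> parcs G
    \<or> length q = 2 \<and> common_nbr G u v \<or> 3 \<le> length q"
proof -
  consider "q = []" | e where "q = [e]" | e f where "q = [e,f]" | e f g r where "q = e # f # g # r"
    by (metis remdups_adj.cases)
  then show ?thesis
  proof cases
    case (2 e)
    with assms show ?thesis by (cases e) (auto simp: awalk_def)
  next
    case (3 e f)
    with assms show ?thesis by (cases e; cases f) (auto simp: awalk_def common_nbr_def)
  qed (use assms in \<open>auto simp: awalk_def\<close>)
qed

lemma geodesic_length_le: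
  assumes "geodesic G u p v" "awalk u q v"
  shows "length p \<le> length q"
  using assms unfolding geodesic_iff by blast

lemma geodesic_awalk: "geodesic G u p v \<Longrightarrow> awalk u p v"
  unfolding geodesic_iff apath_def by blast

lemma geodesic_Nil: "u \<in> pverts G \<Longrightarrow> geodesic G u [] u"
  unfolding geodesic_iff apath_def awalk_def by auto

lemma geodesic_arc:
  assumes "(u,v) \<in> parcs G"
  shows "geodesic G u [(u,v)] v"
proof -
  have uv: "u \<noteq> v" using no_loops'[OF assms] .
  have "length [(u,v)] \<le> length q" if "awalk u q v" for q
    using awalk_length_cases[OF that] uv by auto
  then show ?thesis unfolding geodesic_iff apath_def
    using assms uv wellformed'[OF assms] by (simp add: awalk_def)
qed

lemma geodesic_two:
  assumes "(u,w) \<in> parcs G" "(w,v) \<in> parcs G" "u \<noteq> v" "(u,v) \<notin> parcs G"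
  shows "geodesic G u [(u,w),(w,v)] v"
proof -
  have "length [(u,w),(w,v)] \<le> length q" if "awalk u q v" for q
    using awalk_length_cases[OF that] assms(3,4) by auto
  then show ?thesis unfolding geodesic_iff apath_def
    using assms no_loops'[OF assms(1)] no_loops'[OF assms(2)] wellformed'[OF assms(1)]
    by (simp add: awalk_def)
qed

lemma geodesic_three:
  assumes "(u,w) \<in> parcs G" "(w,z) \<in> parcs G" "(z,v) \<in> parcs G"
    "u \<noteq> v" "(u,v) \<notin> parcs G" "\<not> common_nbr G u v"
  shows "geodesic G u [(u,w),(w,z),(z,v)] v"
proof -
  have "u \<noteq> z" "w \<noteq> v" using assms by auto
  moreover have "length [(u,w),(w,z),(z,v)] \<le> length q" if "awalk u q v" for q
    using awalk_length_cases[OF that] assms(4-6) by auto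
  ultimately show ?thesis unfolding geodesic_iff apath_def
    using assms(1-4) no_loops'[OF assms(1)] no_loops'[OF assms(2)] no_loops'[OF assms(3)]
      wellformed'[OF assms(1)]
    by (simp add: awalk_def)
qed

text \<open>In lower bounds the colouring supplies an unknown geodesic; at distance two its shape is
  forced up to the choice of one common neighbour.\<close>

lemma geodesic_twoD:
  assumes "geodesic G u p v" "common_nbr G u v" "u \<noteq> v" "(u,v) \<notin> parcs G"
  obtains w where "p = [(u,w),(w,v)]" "(u,w) \<in> parcs G" "(w,v) \<in> parcs G"
proof -
  from assms(2) obtain w where w: "(u,w) \<in> parcs G" "(w,v) \<in> parcs G"
    by (auto simp: common_nbr_def)
  then have "awalk u [(u,w),(w,v)] v" using wellformed'[OF w(1)] by (simp add: awalk_def)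
  from geodesic_length_le[OF assms(1) this] have "length p \<le> 2" by simp
  moreover have walk: "awalk u p v" by (rule geodesic_awalk[OF assms(1)])
  ultimately have "length p = 2" using awalk_length_cases[OF walk] assms(3,4) by linarith
  then obtain a b where p: "p = [a,b]" by (auto simp: numeral_2_eq_2 length_Suc_conv)
  obtain a1 a2 b1 b2 where "a = (a1,a2)" "b = (b1,b2)" by (metis surj_pair)
  with p walk have "p = [(u,b1),(b1,v)]" "(u,b1) \<in> parcs G" "(b1,v) \<in> parcs G"
    by (auto simp: awalk_def)
  then show thesis by (rule that)
qed

text \<open>\<open>w\<close> and \<open>z\<close> witness a walk of length three; the geodesic
  itself may run through other vertices.\<close>

lemma geodesic_threeD:
  assumes "geodesic G u p v" "(u,w) \<in> parcs G" "(w,z) \<in> parcs G" "(z,v) \<in> parcs G"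
    "u \<noteq> v" "(u,v) \<notin> parcs G" "\<not> common_nbr G u v"
  obtains w' z' where "p = [(u,w'),(w',z'),(z',v)]"
    "(u,w') \<in> parcs G" "(w',z') \<in> parcs G" "(z',v) \<in> parcs G"
proof -
  have "awalk u [(u,w),(w,z),(z,v)] v"
    using assms(2-4) wellformed'[OF assms(2)] by (simp add: awalk_def)
  from geodesic_length_le[OF assms(1) this] have "length p \<le> 3" by simp
  moreover have walk: "awalk u p v" by (rule geodesic_awalk[OF assms(1)])
  ultimately have "length p = 3" using awalk_length_cases[OF walk] assms(5-7) by linarith
  then obtain a b c where p: "p = [a,b,c]" by (auto simp: numeral_3_eq_3 length_Suc_conv)
  obtain a1 a2 b1 b2 c1 c2 where "a = (a1,a2)" "b = (b1,b2)" "c = (c1,c2)" by (metis surj_pair)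
  with p walk have "p = [(u,b1),(b1,c1),(c1,v)]"
    "(u,b1) \<in> parcs G" "(b1,c1) \<in> parcs G" "(c1,v) \<in> parcs G"
    by (auto simp: awalk_def)
  then show thesis by (rule that)
qed

end

section \<open>Colourings of graphs of diameter at most three\<close>

text \<open>A local certificate for a rainbow geodesic with at most three edges. Excluding common
  neighbours makes the path with three edges shortest; distances 0 and 1 are settled by the first
  alternatives.\<close>

definition total_linked :: "'a pair_pre_digraph \<Rightarrow> ('a + 'a set \<Rightarrow> nat) \<Rightarrow> 'a \<Rightarrow> 'a \<Rightarrow> bool" where
  "total_linked G c u v \<longleftrightarrow> u = v \<or> (u,v) \<in> parcs G
    \<or> (\<exists>w. (u,w) \<in> parcs G \<and> (w,v) \<in> parcs G \<and>
        distinct [c (Inr {u,w}), c (Inl w), c (Inr {w,v})])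
    \<or> (\<not> common_nbr G u v \<and> (\<exists>w z. (u,w) \<in> parcs G \<and> (w,z) \<in> parcs G \<and> (z,v) \<in> parcs G \<and>
        distinct [c (Inr {u,w}), c (Inl w), c (Inr {w,z}), c (Inl z), c (Inr {z,v})]))"

context pair_graph
begin

lemma common_nbr_sym: "common_nbr G u v \<longleftrightarrow> common_nbr G v u"
  unfolding common_nbr_def using arcs_symmetric by blast

text \<open>Reversing a path keeps its colours, so later case analyses may order the two
  vertices.\<close>

lemma total_linked_sym:
  assumes "total_linked G c v u"
  shows "total_linked G c u v"
proof -
  from assms consider "u = v \<or> (v,u) \<in> parcs G"
  | w where "(v,w) \<in> parcs G" "(w,u) \<in> parcs G"
      "distinct [c (Inr {v,w}), c (Inl w), c (Inr {w,u})]"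
  | w z where "\<not> common_nbr G v u" "(v,w) \<in> parcs G" "(w,z) \<in> parcs G" "(z,u) \<in> parcs G"
      "distinct [c (Inr {v,w}), c (Inl w), c (Inr {w,z}), c (Inl z), c (Inr {z,u})]"
    unfolding total_linked_def by blast
  then show ?thesis
  proof cases
    case 1
    then show ?thesis using arcs_symmetric unfolding total_linked_def by blast
  next
    case (2 w)
    then have "distinct [c (Inr {u,w}), c (Inl w), c (Inr {w,v})]"
      by (simp add: insert_commute)
    with 2 arcs_symmetric show ?thesis unfolding total_linked_def by blast
  next
    case (3 w z)
    then have "distinct [c (Inr {u,z}), c (Inl z), c (Inr {z,w}), c (Inl w), c (Inr {w,v})]"
      by (simp add: insert_commute) metis
    with 3 arcs_symmetric common_nbr_sym show ?thesis unfolding total_linked_def by blast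
  qed
qed

lemma total_linked_geodesic:
  assumes "total_linked G c u v" "u \<in> pverts G"
  shows "\<exists>p. geodesic G u p v \<and>
    distinct (map (\<lambda>a. c (Inr (uedge a))) p @ map (\<lambda>x. c (Inl x)) (inner_verts p))"
proof (cases "u = v \<or> (u,v) \<in> parcs G")
  case True
  then show ?thesis
  proof
    assume "u = v"
    then show ?thesis using geodesic_Nil[OF assms(2)] by (intro exI[of _ "[]"]) simp
  next
    assume "(u,v) \<in> parcs G"
    then show ?thesis using geodesic_arc[of u v] by (intro exI[of _ "[(u,v)]"]) simp
  qed
next
  case False
  with assms(1) consider
    w where "(u,w) \<in> parcs G" "(w,v) \<in> parcs G"
      "distinct [c (Inr {u,w}), c (Inl w), c (Inr {w,v})]"
  | w z where "\<not> common_nbr G u v" "(u,w) \<in> parcs G" "(w,z) \<in> parcs G" "(z,v) \<in> parcs G"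
      "distinct [c (Inr {u,w}), c (Inl w), c (Inr {w,z}), c (Inl z), c (Inr {z,v})]"
    unfolding total_linked_def by blast
  then show ?thesis
  proof cases
    case 1
    then show ?thesis using False geodesic_two[of u w v]
      by (intro exI[of _ "[(u,w),(w,v)]"]) (auto simp: inner_verts_with_proj_def)
  next
    case 2
    then show ?thesis using False geodesic_three[of u w z v]
      by (intro exI[of _ "[(u,w),(w,z),(z,v)]"]) (auto simp: inner_verts_with_proj_def)
  qed
qed

lemma strong_rainbow_total_colouringI:
  assumes "\<And>u v. u \<in> pverts G \<Longrightarrow> v \<in> pverts G \<Longrightarrow> total_linked G c u v"
  shows "strong_rainbow_total_colouring G c"
  using assms total_linked_geodesic unfolding strong_rainbow_total_colouring_def by blast

text \<open>Geodesics are walks, so the colouring already witnesses connectedness.\<close>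

lemma strong_rainbow_total_colouring_connected:
  assumes "strong_rainbow_total_colouring G c" "pverts G \<noteq> {}"
  shows "fin_conn_graph G"
proof -
  have "u \<rightarrow>\<^sup>*\<^bsub>with_proj G\<^esub> v" if uv: "u \<in> pverts G" "v \<in> pverts G" for u v
  proof -
    obtain p where "geodesic G u p v"
      using assms(1) uv unfolding strong_rainbow_total_colouring_def by blast
    then show ?thesis by (auto simp: geodesic_iff apath_def reachable_awalk)
  qed
  then have "connected (with_proj G)"
    unfolding connected_def strongly_connected_def
    using assms(2) by (simp add: reachable_mk_symmetricI)
  then show ?thesis unfolding fin_conn_graph_def using pair_graph by blast
qed

end

section \<open>From colourings to bounds on the three minima\<close>

lemma strong_rainbow_total_imp_vertex:
  "strong_rainbow_total_colouring G c \<Longrightarrow> strong_rainbow_vertex_colouring G (\<lambda>x. c (Inl x))"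
  unfolding strong_rainbow_total_colouring_def strong_rainbow_vertex_colouring_def distinct_append
  by blast

lemma strong_rainbow_total_imp_edge:
  "strong_rainbow_total_colouring G c \<Longrightarrow> strong_rainbow_edge_colouring G (\<lambda>e. c (Inr e))"
  unfolding strong_rainbow_total_colouring_def strong_rainbow_edge_colouring_def distinct_append
  by blast

lemma strc_le: "strong_rainbow_total_colouring G c \<Longrightarrow> strc G \<le> card (c ` (pverts G <+> uedges G))"
  unfolding strc_def by (rule Least_le) blast

text \<open>The colouring \<open>c0\<close> makes \<open>LEAST\<close> range over a nonempty set, so
  the minimum is attained by a colouring to which the bound applies.\<close>

lemma le_strcI:
  assumes "strong_rainbow_total_colouring G c0"
    and "\<And>c. strong_rainbow_total_colouring G c \<Longrightarrow> n \<le> card (c ` (pverts G <+> uedges G))"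
  shows "n \<le> strc G"
proof -
  have "\<exists>c. strong_rainbow_total_colouring G c \<and> card (c ` (pverts G <+> uedges G)) = strc G"
    unfolding strc_def by (rule LeastI_ex) (use assms(1) in blast)
  then show ?thesis using assms(2) by metis
qed

lemma src_le: "strong_rainbow_edge_colouring G c \<Longrightarrow> src G \<le> card (c ` uedges G)"
  unfolding src_def by (rule Least_le) blast

lemma le_srcI:
  assumes "strong_rainbow_edge_colouring G c0"
    and "\<And>c. strong_rainbow_edge_colouring G c \<Longrightarrow> n \<le> card (c ` uedges G)"
  shows "n \<le> src G"
proof -
  have "\<exists>c. strong_rainbow_edge_colouring G c \<and> card (c ` uedges G) = src G"
    unfolding src_def by (rule LeastI_ex) (use assms(1) in blast)
  then show ?thesis using assms(2) by metis
qed

lemma srvc_le: "strong_rainbow_vertex_colouring G c \<Longrightarrow> srvc G \<le> card (c ` pverts G)"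
  unfolding srvc_def by (simp, intro impI Least_le) blast

text \<open>The nonadjacent pair \<open>u\<close>, \<open>v\<close> rules out complete graphs, where
  \<open>srvc\<close> is 0 by convention.\<close>

lemma le_srvcI:
  assumes "strong_rainbow_vertex_colouring G c0"
    and "u \<in> pverts G" "v \<in> pverts G" "u \<noteq> v" "(u,v) \<notin> parcs G"
    and "\<And>c. strong_rainbow_vertex_colouring G c \<Longrightarrow> n \<le> card (c ` pverts G)"
  shows "n \<le> srvc G"
proof -
  have "\<not> (\<exists>n. complete_digraph n (with_proj G))"
    using assms(2-5) by (auto simp: complete_digraph_pair_def)
  then have srvc: "srvc G = (LEAST k. \<exists>c. strong_rainbow_vertex_colouring G c \<and> card (c ` pverts G) = k)"
    by (simp add: srvc_def)
  have "\<exists>c. strong_rainbow_vertex_colouring G c \<and> card (c ` pverts G) = srvc G"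
    unfolding srvc by (rule LeastI_ex) (use assms(1) in blast)
  then show ?thesis using assms(6) by metis
qed

lemma srvc_le_strc:
  assumes "finite (pverts G)" "finite (uedges G)" "strong_rainbow_total_colouring G c0"
  shows "srvc G \<le> strc G"
proof (rule le_strcI[OF assms(3)])
  fix c assume "strong_rainbow_total_colouring G c"
  then have "srvc G \<le> card ((\<lambda>x. c (Inl x)) ` pverts G)"
    by (intro srvc_le strong_rainbow_total_imp_vertex)
  also have "\<dots> \<le> card (c ` (pverts G <+> uedges G))"
    using assms by (intro card_mono) auto
  finally show "srvc G \<le> card (c ` (pverts G <+> uedges G))" .
qed

lemma src_le_strc:
  assumes "finite (pverts G)" "finite (uedges G)" "strong_rainbow_total_colouring G c0"
  shows "src G \<le> strc G"
proof (rule le_strcI[OF assms(3)])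
  fix c assume "strong_rainbow_total_colouring G c"
  then have "src G \<le> card ((\<lambda>e. c (Inr e)) ` uedges G)"
    by (intro src_le strong_rainbow_total_imp_edge)
  also have "\<dots> \<le> card (c ` (pverts G <+> uedges G))"
    using assms by (intro card_mono) auto
  finally show "src G \<le> card (c ` (pverts G <+> uedges G))" .
qed

context pair_graph
begin

lemma finite_uedges: "finite (uedges G)"
  by (simp add: uedges_def pair_finite_arcs)

lemma arc_in_uedges: "(u,v) \<in> parcs G \<Longrightarrow> {u,v} \<in> uedges G"
  unfolding uedges_def by (rule image_eqI[of _ _ "(u,v)"]) auto

end

definition simple_graph :: "'a set \<Rightarrow> ('a \<Rightarrow> 'a \<Rightarrow> bool) \<Rightarrow> 'a pair_pre_digraph" where
  "simple_graph V E = \<lparr>pverts = V, parcs = {(u,v). u \<in> V \<and> v \<in> V \<and> E u v}\<rparr>"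

lemma pverts_simple_graph [simp]: "pverts (simple_graph V E) = V"
  and arc_simple_graph [simp]: "(u,v) \<in> parcs (simple_graph V E) \<longleftrightarrow> u \<in> V \<and> v \<in> V \<and> E u v"
  by (simp_all add: simple_graph_def)

lemma pair_graph_simple_graph:
  assumes "finite V" "\<And>u. \<not> E u u" "\<And>u v. E u v \<Longrightarrow> E v u"
  shows "pair_graph (simple_graph V E)"
proof
  have "parcs (simple_graph V E) \<subseteq> V \<times> V" by (auto simp: simple_graph_def)
  then show "finite (parcs (simple_graph V E))" using assms(1) finite_subset by blast
  show "symmetric (with_proj (simple_graph V E))"
    unfolding symmetric_def by (rule symI) (simp add: assms(3))
qed (use assms(1,2) in \<open>auto simp: simple_graph_def\<close>)

lemma three_le_card:
  assumes "finite A" "{a,b,c} \<subseteq> A" "distinct [a,b,c]"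
  shows "3 \<le> card A"
  using card_mono[OF assms(1,2)] assms(3) by simp

section \<open>A five-cycle with one vertex blown up to a clique\<close>

text \<open>Position on the five-cycle: 0 and all numbers from 5 on share class 0, the clique that
  replaces one vertex.\<close>

definition cyc_class :: "nat \<Rightarrow> nat" where
  "cyc_class x = (if x < 5 then x else 0)"

definition cyc_adj :: "nat \<Rightarrow> nat \<Rightarrow> bool" where
  "cyc_adj u v \<longleftrightarrow> u \<noteq> v \<and> (cyc_class u = cyc_class v \<or>
     cyc_class v = (cyc_class u + 1) mod 5 \<or> cyc_class u = (cyc_class v + 1) mod 5)"

lemma cyc_class_simps [simp]: "x < 5 \<Longrightarrow> cyc_class x = x"
  by (simp add: cyc_class_def)

lemma cyc_class_cases:
  obtains "cyc_class x = 0" | "x = 1" | "x = 2" | "x = 3" | "x = 4"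
proof -
  have "5 \<le> x \<or> x = 0 \<or> x = 1 \<or> x = 2 \<or> x = 3 \<or> x = 4" by arith
  then show thesis using that by (auto simp: cyc_class_def)
qed

lemma cyc_adj_class:
  "cyc_class u \<noteq> cyc_class v \<Longrightarrow> cyc_adj u v \<longleftrightarrow>
     cyc_class v = (cyc_class u + 1) mod 5 \<or> cyc_class u = (cyc_class v + 1) mod 5"
  by (auto simp: cyc_adj_def)

definition blown_up_cycle :: "nat \<Rightarrow> nat pair_pre_digraph" where
  "blown_up_cycle n = simple_graph {..<n+5} cyc_adj"

text \<open>The cycle edges 01, 12, 23, 34, 40 receive 1, 2, 1, 2, 3. Edges within the clique fall
  under the default 1 and lie on no geodesic of length two.\<close>

definition cyc_colour :: "nat + nat set \<Rightarrow> nat" where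
  "cyc_colour z = (case z of
     Inl x \<Rightarrow> if cyc_class x = 0 then 2 else if cyc_class x = 4 then 1 else 3
   | Inr e \<Rightarrow> if cyc_class ` e \<in> {{1,2},{3,4}} then 2 else if cyc_class ` e = {0,4} then 3 else 1)"

lemma pair_graph_blown_up_cycle: "pair_graph (blown_up_cycle n)"
  unfolding blown_up_cycle_def
  by (rule pair_graph_simple_graph) (auto simp: cyc_adj_def)

lemma pverts_blown_up_cycle [simp]: "pverts (blown_up_cycle n) = {..<n+5}"
  and arc_blown_up_cycle [simp]:
    "(u,v) \<in> parcs (blown_up_cycle n) \<longleftrightarrow> u < n+5 \<and> v < n+5 \<and> cyc_adj u v"
  by (simp_all add: blown_up_cycle_def)

lemma blown_up_cycle_linked:
  assumes "u < n+5" "v < n+5" "cyc_class u \<le> cyc_class v"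
  shows "total_linked (blown_up_cycle n) cyc_colour u v"
proof (cases "u = v \<or> cyc_adj u v")
  case True
  then show ?thesis using assms by (auto simp: total_linked_def)
next
  case False
  have "cyc_class x \<in> {0,1,2,3,4}" for x
    by (cases x rule: cyc_class_cases) auto
  \<comment> \<open>These are the five pairs of nonadjacent classes of a five-cycle; the class
    between the two supplies \<open>w\<close>.\<close>
  from this[of u] this[of v] False assms(3) consider "cyc_class u = 0" "cyc_class v = 2"
    | "cyc_class u = 0" "cyc_class v = 3" | "cyc_class u = 1" "cyc_class v = 3"
    | "cyc_class u = 1" "cyc_class v = 4" | "cyc_class u = 2" "cyc_class v = 4"
    unfolding cyc_adj_def insert_iff empty_iff by (elim disjE) simp_all
  then have "\<exists>w<5. cyc_adj u w \<and> cyc_adj w v \<and>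
      distinct [cyc_colour (Inr {u,w}), cyc_colour (Inl w), cyc_colour (Inr {w,v})]"
  proof cases
    case 1 then show ?thesis
      by (intro exI[of _ 1]) (simp add: cyc_adj_class cyc_colour_def doubleton_eq_iff)
  next
    case 2 then show ?thesis
      by (intro exI[of _ 4]) (simp add: cyc_adj_class cyc_colour_def doubleton_eq_iff)
  next
    case 3 then show ?thesis
      by (intro exI[of _ 2]) (simp add: cyc_adj_class cyc_colour_def doubleton_eq_iff)
  next
    case 4 then show ?thesis
      by (intro exI[of _ 0]) (simp add: cyc_adj_class cyc_colour_def doubleton_eq_iff)
  next
    case 5 then show ?thesis
      by (intro exI[of _ 3]) (simp add: cyc_adj_class cyc_colour_def doubleton_eq_iff)
  qed
  then obtain w where "w < 5" "cyc_adj u w" "cyc_adj w v"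
      "distinct [cyc_colour (Inr {u,w}), cyc_colour (Inl w), cyc_colour (Inr {w,v})]"
    by blast
  then show ?thesis using assms unfolding total_linked_def arc_blown_up_cycle
    by (intro disjI2 disjI1 exI[of _ w]) simp
qed

lemma strong_rainbow_cyc_colour: "strong_rainbow_total_colouring (blown_up_cycle n) cyc_colour"
proof -
  interpret pair_graph "blown_up_cycle n" by (rule pair_graph_blown_up_cycle)
  show ?thesis
  proof (rule strong_rainbow_total_colouringI)
    fix u v assume "u \<in> pverts (blown_up_cycle n)" "v \<in> pverts (blown_up_cycle n)"
    then show "total_linked (blown_up_cycle n) cyc_colour u v"
      using blown_up_cycle_linked[of u n v] total_linked_sym[OF blown_up_cycle_linked[of v n u]]
      by (cases "cyc_class u \<le> cyc_class v") auto
  qed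
qed

text \<open>Among 1, 2, 3, 4 and the clique, only the nonadjacent pair 1, 4 can have several common
  neighbours. Once the colouring has chosen \<open>w\<close> there, consecutive edges of the
  five-cycle \<open>w\<close>, 1, 2, 3, 4 differ in colour, which two colours cannot achieve on an
  odd cycle.\<close>

lemma three_le_edge_colours_blown_up_cycle:
  assumes c: "strong_rainbow_edge_colouring (blown_up_cycle n) c"
  shows "3 \<le> card (c ` uedges (blown_up_cycle n))"
proof -
  interpret pair_graph "blown_up_cycle n" by (rule pair_graph_blown_up_cycle)
  have two: "\<exists>w. w < n+5 \<and> cyc_adj u w \<and> cyc_adj w v \<and> c {u,w} \<noteq> c {w,v}"
    if "u < n+5" "v < n+5" "u \<noteq> v" "\<not> cyc_adj u v" "\<exists>w<n+5. cyc_adj u w \<and> cyc_adj w v" for u v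
  proof -
    obtain p where p: "geodesic (blown_up_cycle n) u p v" "distinct (map (\<lambda>a. c (uedge a)) p)"
      using c \<open>u < n+5\<close> \<open>v < n+5\<close> unfolding strong_rainbow_edge_colouring_def by fastforce
    show ?thesis
    proof (rule geodesic_twoD[OF p(1)])
      show "common_nbr (blown_up_cycle n) u v" using that by (auto simp: common_nbr_def)
      fix w assume "p = [(u,w),(w,v)]" "(u,w) \<in> parcs (blown_up_cycle n)" "(w,v) \<in> parcs (blown_up_cycle n)"
      with p(2) show ?thesis by (intro exI[of _ w]) simp
    qed (use that in auto)
  qed
  \<comment> \<open>A unique common neighbour \<open>w\<close> leaves a single geodesic, so its two
    edges must differ in colour.\<close>
  have mid: "c {u,w} \<noteq> c {w,v}"
    if uvw: "u < n+5" "v < n+5" "w < 5" "u \<noteq> v" "\<not> cyc_adj u v" "cyc_adj u w" "cyc_adj w v"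
      "\<And>w'. cyc_adj u w' \<Longrightarrow> cyc_adj w' v \<Longrightarrow> w' = w" for u v w
  proof -
    have "w < n+5" using uvw(3) by simp
    then obtain w' where "cyc_adj u w'" "cyc_adj w' v" "c {u,w'} \<noteq> c {w',v}"
      using two[of u v] uvw(1-7) by blast
    then show ?thesis using uvw(8) by metis
  qed
  have "\<exists>w. w < n+5 \<and> cyc_adj 1 w \<and> cyc_adj w 4 \<and> c {1,w} \<noteq> c {w,4}"
  proof (rule two)
    show "\<exists>w<n+5. cyc_adj 1 w \<and> cyc_adj w 4"
      by (rule exI[of _ 0]) (simp add: cyc_adj_def)
  qed (simp_all add: cyc_adj_def)
  then obtain w where w: "w < n+5" "cyc_adj 1 w" "cyc_adj w 4" "c {1,w} \<noteq> c {w,4}" by blast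
  have cw: "cyc_class w = 0" using w(2,3)
    by (cases w rule: cyc_class_cases) (simp_all add: cyc_adj_def)
  then have w': "w \<notin> {1,2,3,4}" by auto
  have w1: "c {w,1} \<noteq> c {1,2}"
  proof (rule mid)
    show "x = 1" if "cyc_adj w x" "cyc_adj x 2" for x
      using that cw by (cases x rule: cyc_class_cases) (simp_all add: cyc_adj_def)
  qed (use w(1) w' cw in \<open>simp_all add: cyc_adj_def\<close>)
  have w4: "c {w,4} \<noteq> c {4,3}"
  proof (rule mid)
    show "x = 4" if "cyc_adj w x" "cyc_adj x 3" for x
      using that cw by (cases x rule: cyc_class_cases) (simp_all add: cyc_adj_def)
  qed (use w(1) w' cw in \<open>simp_all add: cyc_adj_def\<close>)
  have e13: "c {1,2} \<noteq> c {2,3}"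
  proof (rule mid)
    show "x = 2" if "cyc_adj 1 x" "cyc_adj x 3" for x
      using that by (cases x rule: cyc_class_cases) (simp_all add: cyc_adj_def)
  qed (simp_all add: cyc_adj_def)
  have e24: "c {2,3} \<noteq> c {3,4}"
  proof (rule mid)
    show "x = 3" if "cyc_adj 2 x" "cyc_adj x 4" for x
      using that by (cases x rule: cyc_class_cases) (simp_all add: cyc_adj_def)
  qed (simp_all add: cyc_adj_def)
  have edges: "{1,2} \<in> uedges (blown_up_cycle n)" "{2,3} \<in> uedges (blown_up_cycle n)"
    "{3,4} \<in> uedges (blown_up_cycle n)" "{1,w} \<in> uedges (blown_up_cycle n)"
    "{w,4} \<in> uedges (blown_up_cycle n)"
    by (rule arc_in_uedges; use w in \<open>simp add: cyc_adj_def\<close>)+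
  have fin: "finite (c ` uedges (blown_up_cycle n))" using finite_uedges by simp
  \<comment> \<open>If 12 and 34 share a colour, the two edges at \<open>w\<close> differ from it
    and from each other; otherwise 12, 23, 34 already show three colours.\<close>
  show ?thesis
  proof (cases "c {3,4} = c {1,2}")
    case True
    then show ?thesis using w1 w4 w(4) edges
      by (intro three_le_card[OF fin, of "c {1,2}" "c {1,w}" "c {w,4}"])
        (auto simp: insert_commute)
  next
    case False
    then show ?thesis using e13 e24 edges
      by (intro three_le_card[OF fin, of "c {1,2}" "c {2,3}" "c {3,4}"]) auto
  qed
qed

lemma blown_up_cycle_numbers:
  "fin_conn_graph (blown_up_cycle n)" "strc (blown_up_cycle n) = 3" "src (blown_up_cycle n) = 3"
proof -
  interpret pair_graph "blown_up_cycle n" by (rule pair_graph_blown_up_cycle)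
  note c = strong_rainbow_cyc_colour[of n]
  show "fin_conn_graph (blown_up_cycle n)"
    by (rule strong_rainbow_total_colouring_connected[OF c]) (auto simp: lessThan_empty_iff)
  have "cyc_colour z \<in> {1,2,3}" for z by (cases z) (simp_all add: cyc_colour_def)
  then have "card (cyc_colour ` (pverts (blown_up_cycle n) <+> uedges (blown_up_cycle n))) \<le> card {1,2,3::nat}"
    by (intro card_mono) blast+
  then have "strc (blown_up_cycle n) \<le> 3" using strc_le[OF c] by simp
  moreover have "src (blown_up_cycle n) \<le> strc (blown_up_cycle n)"
    by (rule src_le_strc[OF _ finite_uedges c]) simp
  moreover have "3 \<le> src (blown_up_cycle n)"
    by (rule le_srcI[OF strong_rainbow_total_imp_edge[OF c]])
      (rule three_le_edge_colours_blown_up_cycle)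
  ultimately show "strc (blown_up_cycle n) = 3" "src (blown_up_cycle n) = 3" by linarith+
qed

text \<open>The invariant that separates the members of the family, which differ in their number of
  vertices.\<close>

lemma digraph_iso_card_verts:
  assumes "digraph_iso G H"
  shows "card (verts G) = card (verts H)"
  using assms by (auto simp: digraph_iso_def pre_digraph.digraph_isomorphism_def card_image)

section \<open>Cliques with pendant vertices\<close>

text \<open>A number \<open>v\<close> from \<open>t\<close> on is pendant at \<open>v mod t\<close>,
  so below \<open>t * (s + 1)\<close> each of the \<open>t\<close> clique vertices carries
  \<open>s\<close> pendants.\<close>

definition pend_adj :: "nat \<Rightarrow> nat \<Rightarrow> nat \<Rightarrow> bool" where
  "pend_adj t u v \<longleftrightarrow> u \<noteq> v \<and> (u < t \<and> v < t \<or> u < t \<and> t \<le> v \<and> v mod t = u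
     \<or> v < t \<and> t \<le> u \<and> u mod t = v)"

definition pendant_clique :: "nat \<Rightarrow> nat \<Rightarrow> nat pair_pre_digraph" where
  "pendant_clique t s = simple_graph {..<t * (s + 1)} (pend_adj t)"

text \<open>\<open>set_encode\<close> is injective on finite sets, so all edges differ in colour,
  and the offset \<open>t\<close> keeps them apart from the vertex colours. Many edge colours do no
  harm, since only the vertex colours are bounded from above.\<close>

definition pend_colour :: "nat \<Rightarrow> nat + nat set \<Rightarrow> nat" where
  "pend_colour t z = (case z of Inl x \<Rightarrow> x mod t | Inr e \<Rightarrow> t + set_encode e)"

lemma pair_graph_pendant_clique: "pair_graph (pendant_clique t s)"
  unfolding pendant_clique_def
  by (rule pair_graph_simple_graph) (auto simp: pend_adj_def)

lemma pverts_pendant_clique [simp]: "pverts (pendant_clique t s) = {..<t * (s + 1)}"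
  and arc_pendant_clique [simp]: "(u,v) \<in> parcs (pendant_clique t s) \<longleftrightarrow>
    u < t * (s + 1) \<and> v < t * (s + 1) \<and> pend_adj t u v"
  by (simp_all add: pendant_clique_def)

lemma pend_edge_colour_eq [simp]:
  "pend_colour t (Inr {u,v}) = pend_colour t (Inr {x,y}) \<longleftrightarrow> {u,v} = {x,y}"
  by (simp add: pend_colour_def set_encode_eq)

lemma pend_edge_vertex_colour_neq [simp]:
  "t \<ge> 1 \<Longrightarrow> pend_colour t (Inr e) \<noteq> pend_colour t (Inl x)"
  "t \<ge> 1 \<Longrightarrow> pend_colour t (Inl x) \<noteq> pend_colour t (Inr e)"
proof -
  assume "t \<ge> 1"
  then have "x mod t < t + set_encode e" by (intro trans_less_add1) simp
  then show "pend_colour t (Inr e) \<noteq> pend_colour t (Inl x)"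
    "pend_colour t (Inl x) \<noteq> pend_colour t (Inr e)"
    by (simp_all add: pend_colour_def)
qed

lemma pendant_common_nbr:
  assumes "t \<le> u" "t \<le> v" "common_nbr (pendant_clique t s) u v"
  shows "u mod t = v mod t"
  using assms by (auto simp: common_nbr_def pend_adj_def)

lemma pendant_clique_linked:
  assumes t: "t \<ge> 1" and uv: "u < t * (s + 1)" "v < t * (s + 1)" "u \<le> v"
  shows "total_linked (pendant_clique t s) (pend_colour t) u v"
proof (cases "u = v \<or> pend_adj t u v")
  case True
  then show ?thesis using uv by (auto simp: total_linked_def)
next
  case False
  then have v: "t \<le> v" using uv(3) by (auto simp: pend_adj_def)
  have mod: "x mod t < t" for x using t by simp
  have big: "x mod t < t * (s + 1)" for x using mod[of x] by (simp add: trans_less_add1)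
  show ?thesis
  proof (cases "u < t \<or> u mod t = v mod t")
    case True
    have "pend_adj t u (v mod t)" "pend_adj t (v mod t) v"
      using True False v mod[of v] by (auto simp: pend_adj_def)
    then show ?thesis unfolding total_linked_def using t False uv big[of v]
      by (intro disjI2 disjI1 exI[of _ "v mod t"]) (auto simp: doubleton_eq_iff)
  next
    case False2: False
    have less: "u mod t < u" "v mod t < v" "\<not> u < t" "\<not> v < t"
      using mod[of u] mod[of v] False2 v by linarith+
    have "pend_adj t u (u mod t)" "pend_adj t (u mod t) (v mod t)" "pend_adj t (v mod t) v"
      using False2 v mod[of u] mod[of v] less by (simp_all add: pend_adj_def)
    moreover have "\<not> common_nbr (pendant_clique t s) u v"
      using pendant_common_nbr[of t u v] False2 v by auto
    moreover have "pend_colour t (Inl (u mod t)) \<noteq> pend_colour t (Inl (v mod t))"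
      using False2 by (simp add: pend_colour_def)
    ultimately show ?thesis unfolding total_linked_def using t less False False2 uv big[of u] big[of v]
      by (intro disjI2 conjI exI[of _ "u mod t"] exI[of _ "v mod t"]) (auto simp: doubleton_eq_iff)
  qed
qed

lemma strong_rainbow_pend_colour:
  assumes "t \<ge> 1"
  shows "strong_rainbow_total_colouring (pendant_clique t s) (pend_colour t)"
proof -
  interpret pair_graph "pendant_clique t s" by (rule pair_graph_pendant_clique)
  show ?thesis
  proof (rule strong_rainbow_total_colouringI)
    fix u v assume "u \<in> pverts (pendant_clique t s)" "v \<in> pverts (pendant_clique t s)"
    then show "total_linked (pendant_clique t s) (pend_colour t) u v"
      using pendant_clique_linked[of t u s v] total_linked_sym[OF pendant_clique_linked[of t v s u]]
        assms by (cases "u \<le> v") auto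
  qed
qed

section \<open>Lower bounds for cliques with pendant vertices\<close>

lemma t_le_vertex_colours_pendant_clique:
  assumes "s \<ge> 1" and c: "strong_rainbow_vertex_colouring (pendant_clique t s) c"
  shows "t \<le> card (c ` pverts (pendant_clique t s))"
proof -
  interpret pair_graph "pendant_clique t s" by (rule pair_graph_pendant_clique)
  have lt: "i + t < t * (s + 1)" if "i < t" for i
  proof -
    have "t * 2 \<le> t * (s + 1)" using assms(1) by (intro mult_left_mono) auto
    moreover have "i + t < t * 2" using that by simp
    ultimately show ?thesis by (rule less_le_trans[rotated])
  qed
  have "inj_on c {..<t}"
  proof (rule inj_onI, rule ccontr)
    \<comment> \<open>\<open>i + t\<close> is the first pendant at \<open>i\<close>. Every geodesic
      from it to \<open>j + t\<close> has the inner vertices \<open>i\<close> and \<open>j\<close>,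
      so their colours must differ.\<close>
    fix i j assume ij: "i \<in> {..<t}" "j \<in> {..<t}" "c i = c j" "i \<noteq> j"
    then obtain p where p: "geodesic (pendant_clique t s) (i+t) p (j+t)"
        "distinct (map c (inner_verts p))"
      using c lt[of i] lt[of j] unfolding strong_rainbow_vertex_colouring_def by fastforce
    show False
    proof (rule geodesic_threeD[OF p(1), of i j])
      show "\<not> common_nbr (pendant_clique t s) (i+t) (j+t)"
        using pendant_common_nbr[of t "i+t" "j+t"] ij by auto
    qed (use ij p(2) lt[of i] lt[of j] in \<open>auto simp: pend_adj_def inner_verts_with_proj_def\<close>)
  qed
  then have "t = card (c ` {..<t})" by (simp add: card_image)
  also have "\<dots> \<le> card (c ` pverts (pendant_clique t s))"
    by (intro card_mono image_mono) auto
  finally show ?thesis .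
qed

lemma s_le_total_colours_pendant_clique:
  assumes "t \<ge> 1" and c: "strong_rainbow_total_colouring (pendant_clique t s) c"
  shows "s \<le> card (c ` (pverts (pendant_clique t s) <+> uedges (pendant_clique t s)))"
proof -
  interpret pair_graph "pendant_clique t s" by (rule pair_graph_pendant_clique)
  have adj: "pend_adj t 0 (t * k)" "pend_adj t (t * k) 0" "t * k < t * (s + 1)" "t \<le> t * k"
    if "k \<in> {1..s}" for k
  proof -
    have "t * k < t * (s + 1)" using that assms(1) by (intro mult_strict_left_mono) auto
    then show "pend_adj t 0 (t * k)" "pend_adj t (t * k) 0" "t * k < t * (s + 1)" "t \<le> t * k"
      using that assms(1) by (auto simp: pend_adj_def)
  qed
  \<comment> \<open>The multiples \<open>t * k\<close> are the \<open>s\<close> pendants at 0; a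
    geodesic between two of them consists of their pendant edges.\<close>
  have "inj_on (\<lambda>k. c (Inr {0, t * k})) {1..s}"
  proof (rule inj_onI, rule ccontr)
    fix k l assume kl: "k \<in> {1..s}" "l \<in> {1..s}" "c (Inr {0, t * k}) = c (Inr {0, t * l})" "k \<noteq> l"
    note a = adj[OF kl(1)] adj[OF kl(2)]
    obtain p where p: "geodesic (pendant_clique t s) (t*k) p (t*l)"
        "distinct (map (\<lambda>a. c (Inr (uedge a))) p)"
      using c a unfolding strong_rainbow_total_colouring_def by fastforce
    show False
    proof (rule geodesic_twoD[OF p(1)])
      show "common_nbr (pendant_clique t s) (t*k) (t*l)"
        using a assms(1) by (auto simp: common_nbr_def intro!: exI[of _ 0])
      show "t * k \<noteq> t * l" using kl(4) assms(1) by simp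
      show "(t * k, t * l) \<notin> parcs (pendant_clique t s)" using a by (auto simp: pend_adj_def)
      fix w assume "p = [(t*k,w),(w,t*l)]" "(t*k,w) \<in> parcs (pendant_clique t s)"
      moreover from this have "w = 0" using a(4) by (auto simp: pend_adj_def)
      ultimately show False using p(2) kl(3) by (simp add: insert_commute)
    qed
  qed
  then have "s = card ((\<lambda>k. c (Inr {0, t * k})) ` {1..s})" by (simp add: card_image)
  also have "\<dots> \<le> card (c ` (pverts (pendant_clique t s) <+> uedges (pendant_clique t s)))"
  proof (rule card_mono)
    have "{0, t * k} \<in> uedges (pendant_clique t s)" if "k \<in> {1..s}" for k
      using adj[OF that] assms(1) by (intro arc_in_uedges) simp
    then show "(\<lambda>k. c (Inr {0, t * k})) ` {1..s} \<subseteq>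
        c ` (pverts (pendant_clique t s) <+> uedges (pendant_clique t s))"
      by blast
  qed (use finite_uedges in simp)
  finally show ?thesis .
qed

lemma pendant_clique_numbers:
  assumes "1 \<le> t" "t < s"
  shows "fin_conn_graph (pendant_clique t s)" "s \<le> strc (pendant_clique t s)"
    "srvc (pendant_clique t s) = t"
proof -
  interpret pair_graph "pendant_clique t s" by (rule pair_graph_pendant_clique)
  note c = strong_rainbow_pend_colour[OF assms(1), of s]
  show "fin_conn_graph (pendant_clique t s)"
    by (rule strong_rainbow_total_colouring_connected[OF c]) (use assms in \<open>auto simp: lessThan_empty_iff\<close>)
  show "s \<le> strc (pendant_clique t s)"
    by (rule le_strcI[OF c]) (rule s_le_total_colours_pendant_clique[OF assms(1)])
  note cv = strong_rainbow_total_imp_vertex[OF c]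
  have "card ((\<lambda>x. pend_colour t (Inl x)) ` pverts (pendant_clique t s)) \<le> card {..<t}"
    using assms(1) by (intro card_mono) (auto simp: pend_colour_def)
  then have "srvc (pendant_clique t s) \<le> t" using srvc_le[OF cv] by simp
  \<comment> \<open>Two pendants at 0 form the nonadjacent pair; they exist because
    \<open>1 \<le> t < s\<close> gives \<open>s \<ge> 2\<close>.\<close>
  moreover have "t \<le> srvc (pendant_clique t s)"
  proof (rule le_srvcI[OF cv, of "t * 1" "t * 2"])
    show "t * 2 \<in> pverts (pendant_clique t s)" "t * 1 \<in> pverts (pendant_clique t s)"
      unfolding pverts_pendant_clique lessThan_iff using assms by (auto simp del: mult_Suc_right)
    show "t \<le> card (c ` pverts (pendant_clique t s))"
      if "strong_rainbow_vertex_colouring (pendant_clique t s) c" for c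
      using t_le_vertex_colours_pendant_clique[OF _ that] assms by simp
  qed (use assms in \<open>auto simp: pend_adj_def\<close>)
  ultimately show "srvc (pendant_clique t s) = t" by simp
qed

section \<open>A graph with equal vertex and total numbers\<close>

datatype vtx = S nat | X nat nat | Y nat nat

text \<open>The theorem asks for graphs over \<open>nat\<close>; countability provides
  \<open>to_nat\<close> to carry the symbolic vertices there.\<close>

instance vtx :: countable by countable_datatype

text \<open>On pairs with \<open>i < j\<close> the conditions \<open>j = k\<close> and
  \<open>i = l\<close> describe the edges of the shift graph; the \<open>X\<close>-vertices and the
  \<open>Y\<close>-vertices each carry its complement. No edge joins the two kinds, so every path
  from one to the other crosses the clique.\<close>

fun adj :: "vtx \<Rightarrow> vtx \<Rightarrow> bool" where
  "adj (S i) (S j) \<longleftrightarrow> i \<noteq> j"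
| "adj (S k) (X i j) \<longleftrightarrow> k = i"
| "adj (X i j) (S k) \<longleftrightarrow> k = i"
| "adj (S k) (Y i j) \<longleftrightarrow> k = j"
| "adj (Y i j) (S k) \<longleftrightarrow> k = j"
| "adj (X i j) (X k l) \<longleftrightarrow> (i,j) \<noteq> (k,l) \<and> j \<noteq> k \<and> i \<noteq> l"
| "adj (Y i j) (Y k l) \<longleftrightarrow> (i,j) \<noteq> (k,l) \<and> j \<noteq> k \<and> i \<noteq> l"
| "adj (X i j) (Y k l) \<longleftrightarrow> False"
| "adj (Y i j) (X k l) \<longleftrightarrow> False"

fun vert :: "nat \<Rightarrow> vtx \<Rightarrow> bool" where
  "vert s (S i) \<longleftrightarrow> 1 \<le> i \<and> i \<le> s"
| "vert s (X i j) \<longleftrightarrow> 1 \<le> i \<and> i < j \<and> j \<le> s"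
| "vert s (Y i j) \<longleftrightarrow> 1 \<le> i \<and> i < j \<and> j \<le> s"

definition avoid :: "nat \<Rightarrow> nat \<Rightarrow> nat \<Rightarrow> nat" where
  "avoid b i j = (if b \<notin> {i,j} then b else if b + 1 \<notin> {i,j} then b + 1 else b + 2)"

lemma avoid: "b \<le> avoid b i j" "avoid b i j \<le> b + 2" "avoid b i j \<noteq> i" "avoid b i j \<noteq> j"
  by (auto simp: avoid_def)

lemma avoid_commute: "avoid b i j = avoid b j i"
  by (auto simp: avoid_def)

text \<open>
  The three kinds of edges at clique vertices get disjoint palettes of three colours, the least
  size that always leaves a colour different from the colours \<open>i\<close> and \<open>j\<close> of two clique vertices.
\<close>

fun vcol :: "vtx \<Rightarrow> nat" where
  "vcol (S i) = i"
| "vcol (X i j) = 11"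
| "vcol (Y i j) = 11"

text \<open>The values 10 and 12, with the vertex colour 11, make the detour from
  \<open>X i j\<close> via \<open>X i l\<close> to \<open>X j l\<close> rainbow, and likewise for
  \<open>Y\<close>. Between an \<open>X\<close> and a \<open>Y\<close> the value 12 is a mere
  default, as such pairs are not adjacent.\<close>

fun ecol :: "vtx \<Rightarrow> vtx \<Rightarrow> nat" where
  "ecol (S i) (S j) = avoid 1 i j"
| "ecol (S k) (X i j) = avoid 4 i j"
| "ecol (X i j) (S k) = avoid 4 i j"
| "ecol (S k) (Y i j) = avoid 7 i j"
| "ecol (Y i j) (S k) = avoid 7 i j"
| "ecol (X i j) (X k l) = (if i = k then 10 else 12)"
| "ecol (Y i j) (Y k l) = (if i = k then 10 else 12)"
| "ecol (X i j) (Y k l) = 12"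
| "ecol (Y i j) (X k l) = 12"

lemma adj_sym: "adj u v \<Longrightarrow> adj v u"
  by (cases u; cases v) auto

lemma adj_irrefl: "\<not> adj u u"
  by (cases u) auto

lemma ecol_sym: "ecol u v = ecol v u"
  by (cases u; cases v) (auto simp: avoid_commute)

text \<open>Edges are unordered sets; symmetry of \<open>ecol\<close> makes the chosen value
  unique.\<close>

definition ucol :: "vtx set \<Rightarrow> nat" where
  "ucol e = (SOME n. \<exists>u v. e = {u,v} \<and> n = ecol u v)"

lemma ucol_pair [simp]: "ucol {u,v} = ecol u v"
  unfolding ucol_def
  by (rule some_equality) (auto simp: doubleton_eq_iff ecol_sym)

definition shift_graph :: "nat \<Rightarrow> nat pair_pre_digraph" where
  "shift_graph s = simple_graph (to_nat ` {v. vert s v}) (\<lambda>x y. adj (from_nat x) (from_nat y))"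

definition shift_colour :: "nat + nat set \<Rightarrow> nat" where
  "shift_colour z = (case z of Inl x \<Rightarrow> vcol (from_nat x) | Inr e \<Rightarrow> ucol (from_nat ` e))"

lemma shift_colour_simps [simp]:
  "shift_colour (Inl (to_nat u)) = vcol u"
  "shift_colour (Inr {to_nat u, to_nat v}) = ecol u v"
  by (simp_all add: shift_colour_def)

lemma pverts_shift_graph [simp]: "pverts (shift_graph s) = to_nat ` {v. vert s v}"
  by (simp add: shift_graph_def)

lemma arc_shift_graph [simp]:
  "(to_nat u, to_nat v) \<in> parcs (shift_graph s) \<longleftrightarrow> vert s u \<and> vert s v \<and> adj u v"
  by (auto simp: shift_graph_def)

lemma arc_shift_graphE:
  assumes "(x, y) \<in> parcs (shift_graph s)"
  obtains u v where "x = to_nat u" "y = to_nat v" "vert s u" "vert s v" "adj u v"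
  using assms by (auto simp: shift_graph_def)

lemma finite_vert: "finite {v. vert s v}"
proof (rule finite_subset)
  show "{v. vert s v} \<subseteq> S ` {..s} \<union> case_prod X ` ({..s} \<times> {..s}) \<union> case_prod Y ` ({..s} \<times> {..s})"
  proof
    fix v assume "v \<in> {v. vert s v}"
    then show "v \<in> S ` {..s} \<union> case_prod X ` ({..s} \<times> {..s}) \<union> case_prod Y ` ({..s} \<times> {..s})"
      by (cases v) force+
  qed
qed auto

lemma pair_graph_shift_graph: "pair_graph (shift_graph s)"
  unfolding shift_graph_def
  by (rule pair_graph_simple_graph) (auto simp: finite_vert adj_irrefl intro: adj_sym)

lemma common_nbr_shift_graph:
  "common_nbr (shift_graph s) (to_nat u) (to_nat v) \<longleftrightarrow>
     (\<exists>w. vert s u \<and> vert s w \<and> vert s v \<and> adj u w \<and> adj w v)"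
proof
  assume "common_nbr (shift_graph s) (to_nat u) (to_nat v)"
  then obtain x where x: "(to_nat u, x) \<in> parcs (shift_graph s)" "(x, to_nat v) \<in> parcs (shift_graph s)"
    by (auto simp: common_nbr_def)
  obtain w :: vtx where "x = to_nat w" using x(1) by (blast elim: arc_shift_graphE)
  with x show "\<exists>w. vert s u \<and> vert s w \<and> vert s v \<and> adj u w \<and> adj w v" by auto
next
  assume "\<exists>w. vert s u \<and> vert s w \<and> vert s v \<and> adj u w \<and> adj w v"
  then obtain w where "vert s u" "vert s w" "vert s v" "adj u w" "adj w v" by blast
  then have "(to_nat u, to_nat w) \<in> parcs (shift_graph s)"
    "(to_nat w, to_nat v) \<in> parcs (shift_graph s)" by simp_all
  then show "common_nbr (shift_graph s) (to_nat u) (to_nat v)" unfolding common_nbr_def by blast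
qed

text \<open>A common neighbour would be a clique vertex, namely both \<open>S i\<close> and
  \<open>S l\<close>.\<close>

lemma no_common_nbr_X_Y:
  assumes "i \<noteq> l"
  shows "\<not> common_nbr (shift_graph s) (to_nat (X i j)) (to_nat (Y k l))"
proof
  assume "common_nbr (shift_graph s) (to_nat (X i j)) (to_nat (Y k l))"
  then obtain w where "adj (X i j) w" "adj w (Y k l)" by (auto simp: common_nbr_shift_graph)
  then show False using assms by (cases w) auto
qed

lemma linked_adj:
  "vert s u \<Longrightarrow> vert s v \<Longrightarrow> u = v \<or> adj u v \<Longrightarrow>
    total_linked (shift_graph s) shift_colour (to_nat u) (to_nat v)"
  by (auto simp: total_linked_def)

lemma linked_two:
  assumes "vert s u" "vert s w" "vert s v" "adj u w" "adj w v" "distinct [ecol u w, vcol w, ecol w v]"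
  shows "total_linked (shift_graph s) shift_colour (to_nat u) (to_nat v)"
  unfolding total_linked_def using assms
  by (intro disjI2 disjI1 exI[of _ "to_nat w"]) simp

lemma linked_three:
  assumes "vert s u" "vert s w" "vert s z" "vert s v" "adj u w" "adj w z" "adj z v"
    "\<not> common_nbr (shift_graph s) (to_nat u) (to_nat v)"
    "distinct [ecol u w, vcol w, ecol w z, vcol z, ecol z v]"
  shows "total_linked (shift_graph s) shift_colour (to_nat u) (to_nat v)"
  unfolding total_linked_def using assms
  by (intro disjI2 conjI exI[of _ "to_nat w"] exI[of _ "to_nat z"]) simp_all

section \<open>Rainbow geodesics between all pairs of vertices\<close>

lemmas avoid_neq [simp] = avoid(3,4) avoid(3,4)[symmetric]

text \<open>The palette with base \<open>b\<close> ends at \<open>b + 2\<close>, so one with a base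
  beyond that is disjoint from it.\<close>

lemma avoid_palettes_neq [simp]:
  "b + 2 < d \<Longrightarrow> avoid b i j \<noteq> d" "b + 2 < d \<Longrightarrow> d \<noteq> avoid b i j"
  "b + 2 < d \<Longrightarrow> avoid b i j \<noteq> avoid d k l" "b + 2 < d \<Longrightarrow> avoid d k l \<noteq> avoid b i j"
  by (auto simp: avoid_def)

lemma linked_S_X:
  assumes "vert s (S k)" "vert s (X i j)"
  shows "total_linked (shift_graph s) shift_colour (to_nat (S k)) (to_nat (X i j))"
proof (cases "k = i")
  case True
  then show ?thesis using assms by (intro linked_adj) auto
next
  case False
  then show ?thesis using assms by (intro linked_two[of s _ "S i"]) auto
qed

lemma linked_S_Y:
  assumes "vert s (S k)" "vert s (Y i j)"
  shows "total_linked (shift_graph s) shift_colour (to_nat (S k)) (to_nat (Y i j))"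
proof (cases "k = j")
  case True
  then show ?thesis using assms by (intro linked_adj) auto
next
  case False
  then show ?thesis using assms by (intro linked_two[of s _ "S j"]) auto
qed

text \<open>As \<open>i \<le> k < l\<close>, the case \<open>l = i\<close> cannot occur, so
  \<open>j = k\<close> is the only obstacle to adjacency; the detour via \<open>X i l\<close> then
  shows 10, 11, 12.\<close>

lemma linked_X_X:
  assumes "vert s (X i j)" "vert s (X k l)" "i \<le> k"
  shows "total_linked (shift_graph s) shift_colour (to_nat (X i j)) (to_nat (X k l))"
proof (cases "j = k")
  case True
  then show ?thesis using assms by (intro linked_two[of s _ "X i l"]) auto
next
  case False
  then show ?thesis using assms by (intro linked_adj) auto
qed

lemma linked_Y_Y:
  assumes "vert s (Y i j)" "vert s (Y k l)" "i \<le> k"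
  shows "total_linked (shift_graph s) shift_colour (to_nat (Y i j)) (to_nat (Y k l))"
proof (cases "j = k")
  case True
  then show ?thesis using assms by (intro linked_two[of s _ "Y i l"]) auto
next
  case False
  then show ?thesis using assms by (intro linked_adj) auto
qed

text \<open>
  The path through \<open>S i\<close> and \<open>S l\<close> fails only if a pendant edge has the colour of the remote
  clique vertex. That colour then lies strictly between 1 and \<open>s\<close>, so there is room to leave
  through another \<open>X\<close>- or \<open>Y\<close>-vertex attached to that clique vertex.
\<close>

lemma linked_X_Y:
  assumes "vert s (X i j)" "vert s (Y k l)" "13 \<le> s"
  shows "total_linked (shift_graph s) shift_colour (to_nat (X i j)) (to_nat (Y k l))"
proof -
  consider "i = l" | "i \<noteq> l" "avoid 4 i j = l" | "i \<noteq> l" "avoid 4 i j \<noteq> l" "avoid 7 k l = i"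
    | "i \<noteq> l" "avoid 4 i j \<noteq> l" "avoid 7 k l \<noteq> i" by blast
  then show ?thesis
  proof cases
    case 1
    then show ?thesis using assms by (intro linked_two[of s _ "S i"]) auto
  next
    case 2
    \<comment> \<open>The edge from \<open>X i j\<close> to \<open>S i\<close> has the colour of
      \<open>S l\<close>, so the path enters \<open>S l\<close> from \<open>X l m\<close> instead:
      \<open>l < m\<close> makes this a vertex, and \<open>m \<noteq> i\<close> with
      \<open>j \<noteq> l\<close> a neighbour of \<open>X i j\<close>.\<close>
    then have l: "4 \<le> l" "l \<le> 6" "j \<noteq> l" using avoid[of 4 i j] by auto
    obtain m where m: "l < m" "m \<le> 8" "m \<noteq> i"
      using l by (cases "i = 7") (auto intro: that[of 7] that[of 8])
    show ?thesis
      using assms 2 l m no_common_nbr_X_Y[of i l s j k] avoid(1)[of 7 k l] avoid(2)[of 7 k l]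
      by (intro linked_three[of s _ "X l m" "S l"]) auto
  next
    case 3
    \<comment> \<open>Dually, the edge from \<open>S l\<close> to \<open>Y k l\<close> has the
      colour of \<open>S i\<close>, so the path leaves \<open>S i\<close> for \<open>Y m i\<close>:
      \<open>m < i\<close> makes this a vertex, and \<open>m \<noteq> l\<close> with
      \<open>i \<noteq> k\<close> a neighbour of \<open>Y k l\<close>.\<close>
    then have i: "7 \<le> i" "i \<le> 9" "i \<noteq> k" using avoid[of 7 k l] by auto
    obtain m where m: "1 \<le> m" "m < i" "m \<noteq> l"
      using i by (cases "l = 1") (auto intro: that[of 1] that[of 2])
    show ?thesis
      using assms 3 i m no_common_nbr_X_Y[of i l s j k] avoid(2)[of 4 i j] avoid(2)[of 7 m i]
      by (intro linked_three[of s _ "S i" "Y m i"]) auto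
  next
    case 4
    then show ?thesis
      using assms no_common_nbr_X_Y[of i l s j k]
      by (intro linked_three[of s _ "S i" "S l"]) auto
  qed
qed

lemma strong_rainbow_shift_colour:
  assumes "13 \<le> s"
  shows "strong_rainbow_total_colouring (shift_graph s) shift_colour"
proof -
  interpret pair_graph "shift_graph s" by (rule pair_graph_shift_graph)
  have "total_linked (shift_graph s) shift_colour (to_nat u) (to_nat v)"
    if uv: "vert s u" "vert s v" for u v
  proof (cases u)
    case (S k)
    then show ?thesis using uv linked_S_X linked_S_Y linked_adj[of s u v] by (cases v) auto
  next
    case u: (X i j)
    show ?thesis
    proof (cases v)
      case (S k)
      then show ?thesis using uv u linked_S_X total_linked_sym by blast
    next
      case (X k l)
      then show ?thesis using uv u linked_X_X total_linked_sym by (cases "i \<le> k") auto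
    next
      case (Y k l)
      then show ?thesis using uv u linked_X_Y assms by blast
    qed
  next
    case u: (Y i j)
    show ?thesis
    proof (cases v)
      case (S k)
      then show ?thesis using uv u linked_S_Y total_linked_sym by blast
    next
      case (X k l)
      then show ?thesis using uv u linked_X_Y assms total_linked_sym by blast
    next
      case (Y k l)
      then show ?thesis using uv u linked_Y_Y total_linked_sym by (cases "i \<le> k") auto
    qed
  qed
  then show ?thesis by (intro strong_rainbow_total_colouringI) auto
qed

section \<open>Forced geodesics and the lower bound \<open>s\<close>\<close>

lemma vertex_colouring_shift_graph_neq:
  assumes c: "strong_rainbow_vertex_colouring (shift_graph s) c"
    and ij: "1 \<le> i" "i < j" "j \<le> s"
  shows "c (to_nat (S i)) \<noteq> c (to_nat (S j))"
proof -
  interpret pair_graph "shift_graph s" by (rule pair_graph_shift_graph)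
  obtain p where p: "geodesic (shift_graph s) (to_nat (X i j)) p (to_nat (Y i j))"
      "distinct (map c (inner_verts p))"
    using c ij unfolding strong_rainbow_vertex_colouring_def by fastforce
  show ?thesis
  proof (rule geodesic_threeD[OF p(1), of "to_nat (S i)" "to_nat (S j)"])
    show "\<not> common_nbr (shift_graph s) (to_nat (X i j)) (to_nat (Y i j))"
      using ij by (intro no_common_nbr_X_Y) simp
    fix x y
    assume xy: "p = [(to_nat (X i j), x), (x, y), (y, to_nat (Y i j))]"
      "(to_nat (X i j), x) \<in> parcs (shift_graph s)" "(x, y) \<in> parcs (shift_graph s)"
      "(y, to_nat (Y i j)) \<in> parcs (shift_graph s)"
    obtain w z :: vtx where wz: "x = to_nat w" "y = to_nat z" using xy(3) by (blast elim: arc_shift_graphE)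
    \<comment> \<open>Entering \<open>S j\<close> from an \<open>X\<close>-vertex would need one of
      the form \<open>X j l\<close>, and leaving \<open>S i\<close> for a \<open>Y\<close>-vertex
      one of the form \<open>Y k i\<close>; the exceptions in \<open>adj\<close> cut both off from
      the ends of the path.\<close>
    have "w = S i \<and> z = S j" using xy(2-4) unfolding wz by (cases w; cases z) auto
    with xy(1) wz p(2) show ?thesis by (simp add: inner_verts_with_proj_def)
  qed (use ij in auto)
qed

lemma s_le_vertex_colours_shift_graph:
  assumes c: "strong_rainbow_vertex_colouring (shift_graph s) c"
  shows "s \<le> card (c ` pverts (shift_graph s))"
proof -
  have "inj_on (\<lambda>i. c (to_nat (S i))) {1..s}"
    by (rule linorder_inj_onI) (use vertex_colouring_shift_graph_neq[OF c] in auto)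
  then have "s = card ((\<lambda>i. c (to_nat (S i))) ` {1..s})" by (simp add: card_image)
  also have "\<dots> \<le> card (c ` pverts (shift_graph s))"
    by (intro card_mono) (auto simp: finite_vert)
  finally show ?thesis .
qed

lemma shift_graph_numbers:
  assumes "13 \<le> s"
  shows "fin_conn_graph (shift_graph s)" "strc (shift_graph s) = s" "srvc (shift_graph s) = s"
proof -
  interpret pair_graph "shift_graph s" by (rule pair_graph_shift_graph)
  note c = strong_rainbow_shift_colour[OF assms]
  have S1: "vert s (S 1)" and Y: "vert s (Y 1 2)" using assms by auto
  show "fin_conn_graph (shift_graph s)"
    by (rule strong_rainbow_total_colouring_connected[OF c]) (use S1 in \<open>auto simp del: vert.simps\<close>)
  \<comment> \<open>The palettes end at 9 and the other fixed colours are 10, 11, 12, so the colours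
    1 to \<open>s\<close> of the clique cover everything.\<close>
  have "avoid b i j \<in> {1..s}" if "1 \<le> b" "b \<le> 11" for b i j
    using that assms by (simp add: avoid_def)
  then have "ecol u v \<in> {1..s}" for u v using assms by (cases u; cases v) simp_all
  moreover have "vcol u \<in> {1..s}" if "vert s u" for u using that assms by (cases u) auto
  ultimately have "shift_colour ` (pverts (shift_graph s) <+> uedges (shift_graph s)) \<subseteq> {1..s}"
    by (force simp: uedges_def elim!: arc_shift_graphE)
  then have "card (shift_colour ` (pverts (shift_graph s) <+> uedges (shift_graph s))) \<le> card {1..s}"
    by (intro card_mono) auto
  then have "strc (shift_graph s) \<le> s" using strc_le[OF c] by simp
  moreover have "srvc (shift_graph s) \<le> strc (shift_graph s)"
    by (rule srvc_le_strc[OF _ finite_uedges c]) (simp add: finite_vert)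
  \<comment> \<open>\<open>Y 1 2\<close> is attached to \<open>S 2\<close>, hence not adjacent to
    \<open>S 1\<close>, and the graph is not complete.\<close>
  moreover have "s \<le> srvc (shift_graph s)"
    by (rule le_srvcI[OF strong_rainbow_total_imp_vertex[OF c], of "to_nat (S 1)" "to_nat (Y 1 2)"])
      (use S1 Y s_le_vertex_colours_shift_graph in auto)
  ultimately show "strc (shift_graph s) = s" "srvc (shift_graph s) = s" by linarith+
qed

theorem theorem4p2:
  shows "(\<exists>F :: nat pair_pre_digraph set. infinite F \<and>
            pairwise (\<lambda>G H. \<not> digraph_iso (with_proj G) (with_proj H)) F \<and>
            (\<forall>G \<in> F. fin_conn_graph G \<and> strc G = 3 \<and> src G = 3)) \<and>
         (\<forall>s :: nat. 13 \<le> s \<longrightarrow>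
            (\<exists>G :: nat pair_pre_digraph. fin_conn_graph G \<and> strc G = s \<and> srvc G = s)) \<and>
         (\<forall>s t :: nat. 1 \<le> t \<and> t < s \<longrightarrow>
            (\<exists>G :: nat pair_pre_digraph. fin_conn_graph G \<and> strc G \<ge> s \<and> srvc G = t))"
proof (intro conjI allI impI)
  \<comment> \<open>Member \<open>n\<close> has \<open>n + 5\<close> vertices; this count yields
    both infinitely many members and, below, their pairwise non-isomorphism.\<close>
  have "n = m" if "blown_up_cycle n = blown_up_cycle m" for n m
    using arg_cong[OF that, of "\<lambda>G. card (pverts G)"] by simp
  then have "inj blown_up_cycle" by (rule injI)
  then have "infinite (range blown_up_cycle)" by (rule range_inj_infinite)
  moreover have "pairwise (\<lambda>G H. \<not> digraph_iso (with_proj G) (with_proj H)) (range blown_up_cycle)"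
  proof (rule pairwiseI)
    fix G H assume "G \<in> range blown_up_cycle" "H \<in> range blown_up_cycle" "G \<noteq> H"
    then obtain n m where "G = blown_up_cycle n" "H = blown_up_cycle m" "n \<noteq> m" by blast
    then show "\<not> digraph_iso (with_proj G) (with_proj H)"
      using digraph_iso_card_verts[of "with_proj G" "with_proj H"] by auto
  qed
  ultimately show "\<exists>F :: nat pair_pre_digraph set. infinite F \<and>
      pairwise (\<lambda>G H. \<not> digraph_iso (with_proj G) (with_proj H)) F \<and>
      (\<forall>G \<in> F. fin_conn_graph G \<and> strc G = 3 \<and> src G = 3)"
    using blown_up_cycle_numbers by (intro exI[of _ "range blown_up_cycle"]) blast
next
  fix s :: nat
  assume "13 \<le> s"
  from shift_graph_numbers[OF this]
  show "\<exists>G :: nat pair_pre_digraph. fin_conn_graph G \<and> strc G = s \<and> srvc G = s" by blast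
next
  fix s t :: nat
  assume "1 \<le> t \<and> t < s"
  then show "\<exists>G :: nat pair_pre_digraph. fin_conn_graph G \<and> strc G \<ge> s \<and> srvc G = t"
    using pendant_clique_numbers[of t s] by blast
qed

end
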